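(* Let $(X,r)$ be a bijective left non-degenerate solution, let $(X,\triangleright)$ be its associated left rack (with $\triangleright=\triangleright_r$), and let $\kappa:X\to X$ be a $\lambda$-centralizing map. Then the following hold: 1. If $\kappa\in C_{\mathrm{End}(X,\triangleright)}(\mathrm{LMlt}(X,\triangleright))$, then $\kappa$ is a reflection for $(X,r)$. 2. If $\kappa$ is an injective reflection for $(X,r)$, then $\kappa\in C_{\mathrm{End}(X,\triangleright)}(\mathrm{LMlt}(X,\triangleright))$. 3. In particular, $\kappa$ is a bijective reflection for $(X,r)$ if and only if $\kappa\in C_{\mathrm{Aut}(X,\triangleright)}(\mathrm{LMlt}(X,\triangleright))$.
   Context: A (set-theoretic) solution (of the Yang-Baxter equation) is a pair $(X,r)$ with $X$ a set and $r:X\times X\to X\times X$ a map satisfying $(r\times \mathrm{id}_X)(\mathrm{id}_X\times r)(r\times \mathrm{id}_X)=(\mathrm{id}_X\times r)(r\times \mathrm{id}_X)(\mathrm{id}_X\times r)$. Write $r(x,y)=(\lambda_x(y),\rho_y(x))$. The solution is bijective if $r$ is bijective, and left non-degenerate if every $\lambda_x:X\to X$ is bijective. A reflection for $(X,r)$ is a map $\kappa:X\to X$ with $r(\mathrm{id}_X\times\kappa)r(\mathrm{id}_X\times\kappa)=(\mathrm{id}_X\times\kappa)r(\mathrm{id}_X\times\kappa)r$. A map $\kappa:X\to X$ is $\lambda$-centralizing if $\lambda_x\kappa=\kappa\lambda_x$ for all $x\in X$. A left shelf $(X,\triangleright)$ is a set with a binary operation satisfying $x\triangleright(y\triangleright z)=(x\triangleright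 y)\triangleright(x\triangleright z)$; put $L_x(y)=x\triangleright y$. It is a left rack if all $L_x$ are bijective. $\mathrm{End}(X,\triangleright)$ and $\mathrm{Aut}(X,\triangleright)$ are the monoid of endomorphisms (maps preserving $\triangleright$) and the group of automorphisms. For a left rack, $\mathrm{LMlt}(X,\triangleright):=\langle L_x\mid x\in X\rangle$ is the subgroup of $\mathrm{Aut}(X,\triangleright)$ generated by the left multiplications. For a monoid $M$ and a subset $S$, $C_M(S)$ is the centralizer of $S$ in $M$. The left shelf associated to a left non-degenerate solution $(X,r)$ is $(X,\triangleright_r)$ with $x\triangleright_r y:=\lambda_x\rho_{\lambda_y^{-1}(x)}(y)$; it is known to be a left rack when $r$ is bijective. *)

theory Defs
  imports "HOL-Algebra.Bij" "HOL-Algebra.Generated_Groups"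
begin

text \<open>
  Sets are carriers \<open>X :: 'a set\<close>. As in \<^theory>\<open>HOL-Algebra.Bij\<close>, the self-maps of \<open>X\<close> are
  represented by the extensional functions \<open>X \<rightarrow>\<^sub>E X\<close>, composed with \<^const>\<open>compose\<close>, so that two
  maps agreeing on \<open>X\<close> are equal. A map \<open>r\<close> or a binary operation is only ever evaluated
  on \<open>X\<close>.
\<close>

section \<open>Set-theoretic solutions and reflections\<close>

text \<open>The maps \<open>r \<times> id\<close> and \<open>id \<times> r\<close> on triples, which are nested to the right in HOL.\<close>

definition r12 :: "('a \<times> 'a \<Rightarrow> 'a \<times> 'a) \<Rightarrow> 'a \<times> 'a \<times> 'a \<Rightarrow> 'a \<times> 'a \<times> 'a" where
  "r12 r = (\<lambda>(x, y, z). case r (x, y) of (a, b) \<Rightarrow> (a, b, z))"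

definition r23 :: "('a \<times> 'a \<Rightarrow> 'a \<times> 'a) \<Rightarrow> 'a \<times> 'a \<times> 'a \<Rightarrow> 'a \<times> 'a \<times> 'a" where
  "r23 r = map_prod id r"

definition YB_solution :: "'a set \<Rightarrow> ('a \<times> 'a \<Rightarrow> 'a \<times> 'a) \<Rightarrow> bool" where
  "YB_solution X r \<longleftrightarrow>
     r \<in> X \<times> X \<rightarrow> X \<times> X \<and>
     (\<forall>t \<in> X \<times> X \<times> X. (r12 r \<circ> r23 r \<circ> r12 r) t = (r23 r \<circ> r12 r \<circ> r23 r) t)"

text \<open>\<open>r (x, y) = (lam r x y, rho r y x)\<close>\<close>

definition lam :: "('a \<times> 'a \<Rightarrow> 'a \<times> 'a) \<Rightarrow> 'a \<Rightarrow> 'a \<Rightarrow> 'a" where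
  "lam r x y = fst (r (x, y))"

definition rho :: "('a \<times> 'a \<Rightarrow> 'a \<times> 'a) \<Rightarrow> 'a \<Rightarrow> 'a \<Rightarrow> 'a" where
  "rho r y x = snd (r (x, y))"

definition bijective_solution :: "'a set \<Rightarrow> ('a \<times> 'a \<Rightarrow> 'a \<times> 'a) \<Rightarrow> bool" where
  "bijective_solution X r \<longleftrightarrow> YB_solution X r \<and> bij_betw r (X \<times> X) (X \<times> X)"

definition left_nondegenerate :: "'a set \<Rightarrow> ('a \<times> 'a \<Rightarrow> 'a \<times> 'a) \<Rightarrow> bool" where
  "left_nondegenerate X r \<longleftrightarrow> (\<forall>x \<in> X. bij_betw (lam r x) X X)"

definition reflection :: "'a set \<Rightarrow> ('a \<times> 'a \<Rightarrow> 'a \<times> 'a) \<Rightarrow> ('a \<Rightarrow> 'a) \<Rightarrow> bool" where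
  "reflection X r \<kappa> \<longleftrightarrow>
     \<kappa> \<in> X \<rightarrow>\<^sub>E X \<and>
     (\<forall>p \<in> X \<times> X. (r \<circ> map_prod id \<kappa> \<circ> r \<circ> map_prod id \<kappa>) p
                  = (map_prod id \<kappa> \<circ> r \<circ> map_prod id \<kappa> \<circ> r) p)"

definition lambda_centralizing :: "'a set \<Rightarrow> ('a \<times> 'a \<Rightarrow> 'a \<times> 'a) \<Rightarrow> ('a \<Rightarrow> 'a) \<Rightarrow> bool" where
  "lambda_centralizing X r \<kappa> \<longleftrightarrow>
     \<kappa> \<in> X \<rightarrow>\<^sub>E X \<and> (\<forall>x \<in> X. \<forall>y \<in> X. lam r x (\<kappa> y) = \<kappa> (lam r x y))"

section \<open>Left shelves and racks\<close>

definition shelf_op :: "'a set \<Rightarrow> ('a \<times> 'a \<Rightarrow> 'a \<times> 'a) \<Rightarrow> 'a \<Rightarrow> 'a \<Rightarrow> 'a" where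
  "shelf_op X r x y = lam r x (rho r (inv_into X (lam r y) x) y)"

definition End_monoid :: "'a set \<Rightarrow> ('a \<Rightarrow> 'a \<Rightarrow> 'a) \<Rightarrow> ('a \<Rightarrow> 'a) monoid" where
  "End_monoid X tr =
     \<lparr>carrier = {f \<in> X \<rightarrow>\<^sub>E X. \<forall>x \<in> X. \<forall>y \<in> X. f (tr x y) = tr (f x) (f y)},
      mult = compose X,
      one = (\<lambda>x \<in> X. x)\<rparr>"

definition Aut_group :: "'a set \<Rightarrow> ('a \<Rightarrow> 'a \<Rightarrow> 'a) \<Rightarrow> ('a \<Rightarrow> 'a) monoid" where
  "Aut_group X tr = (End_monoid X tr)\<lparr>carrier := carrier (End_monoid X tr) \<inter> Bij X\<rparr>"

definition left_mult :: "'a set \<Rightarrow> ('a \<Rightarrow> 'a \<Rightarrow> 'a) \<Rightarrow> 'a \<Rightarrow> 'a \<Rightarrow> 'a" where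
  "left_mult X tr x = (\<lambda>y \<in> X. tr x y)"

text \<open>Meaningful for left racks, where every left multiplication is an automorphism.\<close>

definition LMlt :: "'a set \<Rightarrow> ('a \<Rightarrow> 'a \<Rightarrow> 'a) \<Rightarrow> ('a \<Rightarrow> 'a) set" where
  "LMlt X tr = generate (Aut_group X tr) (left_mult X tr ` X)"

definition centralizer :: "('m, 'b) monoid_scheme \<Rightarrow> 'm set \<Rightarrow> 'm set" where
  "centralizer M S = {a \<in> carrier M. \<forall>s \<in> S. a \<otimes>\<^bsub>M\<^esub> s = s \<otimes>\<^bsub>M\<^esub> a}"

end

theory Submission
  imports Defs
begin

text \<open>
  The shear \<open>(x, y) \<mapsto> (x, \<lambda>\<^sub>x y)\<close> is a bijection of \<open>X \<times> X\<close> because the solution is left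
  non-degenerate. It conjugates \<open>r\<close> to the map \<open>(y, u) \<mapsto> (u, u \<triangleright> y)\<close>, which involves the
  associated shelf alone (\<open>shear_r\<close>), and it commutes with \<open>id \<times> \<kappa>\<close> because \<open>\<kappa>\<close> is
  \<open>\<lambda>\<close>-centralizing. The reflection equation can therefore be transported along the shear, where
  both sides can be computed. For all \<open>u\<close> and \<open>y\<close> it says (\<open>reflection_iff_shelf_equations\<close>)
  \<open>\<kappa> (\<kappa> u \<triangleright> y) = \<kappa> (u \<triangleright> y)\<close> and
  \<open>\<kappa> (\<kappa> u \<triangleright> y) \<triangleright> \<kappa> u = \<kappa> (\<kappa> (u \<triangleright> y) \<triangleright> u)\<close>.

  If \<open>\<kappa>\<close> is an endomorphism commuting with every \<open>L\<^sub>x\<close>, then both sides of the first equation are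
  \<open>\<kappa> u \<triangleright> \<kappa> y\<close>, and both sides of the second one are \<open>\<kappa> (u \<triangleright> y) \<triangleright> \<kappa> u\<close>. Conversely, if \<open>\<kappa>\<close>
  is injective, the first equation says \<open>L (\<kappa> u) = L u\<close>. With \<open>w = u \<triangleright> y\<close> the second one becomes
  \<open>w \<triangleright> \<kappa> u = \<kappa> (w \<triangleright> u)\<close>, and for a fixed \<open>u\<close> every \<open>w \<in> X\<close> has this form since \<open>L\<^sub>u\<close> is
  surjective. So \<open>\<kappa>\<close> commutes with every \<open>L\<^sub>w\<close>, and replacing \<open>L\<^sub>w\<close> by
  \<open>L (\<kappa> w)\<close> in \<open>w \<triangleright> \<kappa> u = \<kappa> (w \<triangleright> u)\<close> shows that \<open>\<kappa>\<close> is an endomorphism.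

  Passing from the generators \<open>L\<^sub>x\<close> to the whole group \<open>LMlt\<close> uses that the \<open>L\<^sub>x\<close> are automorphisms,
  so that their group inverses exist. This is the statement that the associated shelf is a rack:
  the \<open>L\<^sub>x\<close> are bijective because \<open>r\<close> is (\<open>bij_betw_shelf_op\<close>), and self-distributivity
  (\<open>shelf_op_self_distrib\<close>) is the Yang--Baxter equation after shearing the triples.
\<close>

section \<open>Centralizers of left multiplications\<close>

lemma monoid_End_monoid:
  assumes closed: "\<And>x y. x \<in> X \<Longrightarrow> y \<in> X \<Longrightarrow> tr x y \<in> X"
  shows "monoid (End_monoid X tr)"
proof (rule monoidI)
  fix f g assume fg: "f \<in> carrier (End_monoid X tr)" "g \<in> carrier (End_monoid X tr)"
  then have "g x \<in> X" "f x \<in> X" if "x \<in> X" for x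
    using that by (auto simp: End_monoid_def)
  then show "f \<otimes>\<^bsub>End_monoid X tr\<^esub> g \<in> carrier (End_monoid X tr)"
    using fg closed by (simp add: End_monoid_def compose_def)
next
  show "\<one>\<^bsub>End_monoid X tr\<^esub> \<in> carrier (End_monoid X tr)"
    using closed by (simp add: End_monoid_def)
next
  fix f g h assume "f \<in> carrier (End_monoid X tr)" "g \<in> carrier (End_monoid X tr)"
    "h \<in> carrier (End_monoid X tr)"
  then have "h \<in> X \<rightarrow> X" by (auto simp: End_monoid_def)
  then show "f \<otimes>\<^bsub>End_monoid X tr\<^esub> g \<otimes>\<^bsub>End_monoid X tr\<^esub> h
      = f \<otimes>\<^bsub>End_monoid X tr\<^esub> (g \<otimes>\<^bsub>End_monoid X tr\<^esub> h)"
    by (simp add: End_monoid_def compose_assoc[of h X X])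
next
  fix f assume "f \<in> carrier (End_monoid X tr)"
  then have "f \<in> X \<rightarrow> X" "f \<in> extensional X" by (auto simp: End_monoid_def PiE_def)
  then show "\<one>\<^bsub>End_monoid X tr\<^esub> \<otimes>\<^bsub>End_monoid X tr\<^esub> f = f"
    and "f \<otimes>\<^bsub>End_monoid X tr\<^esub> \<one>\<^bsub>End_monoid X tr\<^esub> = f"
    by (simp_all add: End_monoid_def Id_compose compose_Id)
qed

lemma group_Aut_group:
  assumes closed: "\<And>x y. x \<in> X \<Longrightarrow> y \<in> X \<Longrightarrow> tr x y \<in> X"
  shows "group (Aut_group X tr)"
proof -
  interpret E: monoid "End_monoid X tr" using closed by (rule monoid_End_monoid)
  show ?thesis
  proof (rule groupI)
    fix f g assume fg: "f \<in> carrier (Aut_group X tr)" "g \<in> carrier (Aut_group X tr)"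
    then have "f \<otimes>\<^bsub>End_monoid X tr\<^esub> g \<in> carrier (End_monoid X tr)"
      by (intro E.m_closed) (auto simp: Aut_group_def)
    moreover have "compose X f g \<in> Bij X" using fg by (simp add: Aut_group_def compose_Bij)
    ultimately show "f \<otimes>\<^bsub>Aut_group X tr\<^esub> g \<in> carrier (Aut_group X tr)"
      by (simp add: Aut_group_def End_monoid_def)
  next
    show "\<one>\<^bsub>Aut_group X tr\<^esub> \<in> carrier (Aut_group X tr)"
      using E.one_closed by (simp add: Aut_group_def) (simp add: End_monoid_def id_Bij)
  next
    fix f g h assume "f \<in> carrier (Aut_group X tr)" "g \<in> carrier (Aut_group X tr)"
      "h \<in> carrier (Aut_group X tr)"
    then show "f \<otimes>\<^bsub>Aut_group X tr\<^esub> g \<otimes>\<^bsub>Aut_group X tr\<^esub> h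
        = f \<otimes>\<^bsub>Aut_group X tr\<^esub> (g \<otimes>\<^bsub>Aut_group X tr\<^esub> h)"
      by (simp add: Aut_group_def E.m_assoc)
  next
    fix f assume "f \<in> carrier (Aut_group X tr)"
    then show "\<one>\<^bsub>Aut_group X tr\<^esub> \<otimes>\<^bsub>Aut_group X tr\<^esub> f = f"
      by (simp add: Aut_group_def)
  next
    fix f assume f: "f \<in> carrier (Aut_group X tr)"
    define g where "g = (\<lambda>x \<in> X. inv_into X f x)"
    have bij: "bij_betw f X X" and hom: "\<And>x y. x \<in> X \<Longrightarrow> y \<in> X \<Longrightarrow> f (tr x y) = tr (f x) (f y)"
      using f by (auto simp: Aut_group_def End_monoid_def Bij_def)
    have gB: "g \<in> Bij X" unfolding g_def
      using f by (intro restrict_inv_into_Bij) (simp add: Aut_group_def)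
    have "g (tr x y) = tr (g x) (g y)" if "x \<in> X" "y \<in> X" for x y
    proof (rule inj_onD[OF bij_betw_imp_inj_on[OF bij]])
      show "f (g (tr x y)) = f (tr (g x) (g y))"
        using that bij closed
        by (simp add: g_def hom bij_betw_inv_into_right bij_betw_apply[OF bij_betw_inv_into])
    qed (use that bij closed in \<open>auto simp: g_def bij_betw_apply[OF bij_betw_inv_into]\<close>)
    then have "g \<in> carrier (Aut_group X tr)"
      using gB by (auto simp: Aut_group_def End_monoid_def Bij_def bij_betw_def PiE_def)
    moreover have "g \<otimes>\<^bsub>Aut_group X tr\<^esub> f = \<one>\<^bsub>Aut_group X tr\<^esub>"
      using f by (simp add: g_def Aut_group_def End_monoid_def Bij_compose_restrict_eq)
    ultimately show "\<exists>g \<in> carrier (Aut_group X tr). g \<otimes>\<^bsub>Aut_group X tr\<^esub> f = \<one>\<^bsub>Aut_group X tr\<^esub>"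
      by blast
  qed
qed

text \<open>
  The centralized element may lie outside the group: it lives in \<open>End_monoid\<close> while the generators
  are inverted in \<open>Aut_group\<close>, so the computation with inverses is carried out in a monoid that
  shares its operations with a group on a smaller carrier.
\<close>

lemma (in monoid) commutes_with_generate:
  assumes sub: "C \<subseteq> carrier G" and grp: "group (G\<lparr>carrier := C\<rparr>)"
    and H: "H \<subseteq> C" and k: "k \<in> carrier G"
    and comm: "\<And>h. h \<in> H \<Longrightarrow> k \<otimes> h = h \<otimes> k"
    and s: "s \<in> generate (G\<lparr>carrier := C\<rparr>) H"
  shows "k \<otimes> s = s \<otimes> k"
  using s
proof induction
  case one
  then show ?case using k by simp
next
  case (incl h)
  then show ?case by (rule comm)
next
  interpret A: group "G\<lparr>carrier := C\<rparr>" by (rule grp)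
  case (inv h)
  define i where "i = inv\<^bsub>G\<lparr>carrier := C\<rparr>\<^esub> h"
  have hC: "h \<in> C" using inv H by blast
  then have "i \<in> C" "i \<otimes> h = \<one>" "h \<otimes> i = \<one>"
    unfolding i_def using A.inv_closed[of h] A.l_inv[of h] A.r_inv[of h] by auto
  note i = this
  have mem: "h \<in> carrier G" "i \<in> carrier G" using hC i(1) sub by auto
  have "k \<otimes> i = (i \<otimes> h) \<otimes> (k \<otimes> i)" using i k mem by simp
  also have "\<dots> = i \<otimes> (h \<otimes> k) \<otimes> i" using k mem by (simp add: m_assoc)
  also have "\<dots> = i \<otimes> (k \<otimes> h) \<otimes> i" using comm inv by simp
  also have "\<dots> = i \<otimes> k \<otimes> (h \<otimes> i)" using k mem by (simp add: m_assoc)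
  also have "\<dots> = i \<otimes> k" using i k mem by simp
  finally show ?case unfolding i_def .
next
  interpret A: group "G\<lparr>carrier := C\<rparr>" by (rule grp)
  case (eng h1 h2)
  have "h1 \<in> carrier G" "h2 \<in> carrier G"
    using eng(1,2) A.generate_in_carrier[of H] H sub by auto
  note mem = this
  have "k \<otimes> (h1 \<otimes> h2) = h1 \<otimes> k \<otimes> h2" using eng(3) k mem by (simp add: m_assoc[symmetric])
  also have "\<dots> = h1 \<otimes> h2 \<otimes> k" using eng(4) k mem by (simp add: m_assoc)
  finally show ?case by simp
qed

lemma compose_left_mult_commute_iff:
  assumes "\<kappa> \<in> X \<rightarrow>\<^sub>E X" and "\<And>y. y \<in> X \<Longrightarrow> tr x y \<in> X"
  shows "compose X \<kappa> (left_mult X tr x) = compose X (left_mult X tr x) \<kappa>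
    \<longleftrightarrow> (\<forall>y \<in> X. \<kappa> (tr x y) = tr x (\<kappa> y))"
  using assms by (auto simp: compose_def left_mult_def fun_eq_iff restrict_def dest: PiE_mem)

text \<open>
  The rack axioms make every \<open>L\<^sub>x\<close> an element of \<open>Aut_group\<close>, so the inverses in \<^const>\<open>generate\<close>
  are inverse maps, and centralizing \<open>LMlt\<close> reduces to commuting with the generators.
\<close>

lemma centralizer_LMlt_iff:
  assumes closed: "\<And>x y. x \<in> X \<Longrightarrow> y \<in> X \<Longrightarrow> tr x y \<in> X"
    and bij: "\<And>x. x \<in> X \<Longrightarrow> bij_betw (tr x) X X"
    and distrib: "\<And>x y z. x \<in> X \<Longrightarrow> y \<in> X \<Longrightarrow> z \<in> X \<Longrightarrow> tr x (tr y z) = tr (tr x y) (tr x z)"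
  shows "\<kappa> \<in> centralizer (End_monoid X tr) (LMlt X tr) \<longleftrightarrow>
    \<kappa> \<in> X \<rightarrow>\<^sub>E X \<and> (\<forall>x \<in> X. \<forall>y \<in> X. \<kappa> (tr x y) = tr (\<kappa> x) (\<kappa> y) \<and> \<kappa> (tr x y) = tr x (\<kappa> y))"
    (is "?L \<longleftrightarrow> ?R")
proof
  assume L: ?L
  then have \<kappa>: "\<kappa> \<in> X \<rightarrow>\<^sub>E X" by (simp add: centralizer_def End_monoid_def)
  have "compose X \<kappa> (left_mult X tr x) = compose X (left_mult X tr x) \<kappa>" if "x \<in> X" for x
  proof -
    have "left_mult X tr x \<in> LMlt X tr" using that by (simp add: LMlt_def generate.incl)
    then show ?thesis using L by (simp add: centralizer_def End_monoid_def)
  qed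
  then show ?R
    using L \<kappa> closed by (simp add: compose_left_mult_commute_iff centralizer_def End_monoid_def)
next
  assume R: ?R
  then have \<kappa>: "\<kappa> \<in> X \<rightarrow>\<^sub>E X"
    and comm: "\<And>x y. x \<in> X \<Longrightarrow> y \<in> X \<Longrightarrow> \<kappa> (tr x y) = tr x (\<kappa> y)"
    by blast+
  from R have k: "\<kappa> \<in> carrier (End_monoid X tr)" by (simp add: End_monoid_def)
  have L_Aut: "left_mult X tr ` X \<subseteq> carrier (Aut_group X tr)"
  proof
    fix l assume "l \<in> left_mult X tr ` X"
    then obtain x where x: "x \<in> X" "l = left_mult X tr x" by blast
    have "bij_betw l X X \<longleftrightarrow> bij_betw (tr x) X X"
      unfolding x by (rule bij_betw_cong) (simp add: left_mult_def)
    then show "l \<in> carrier (Aut_group X tr)"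
      using x bij closed
      by (auto simp: distrib[OF x(1), symmetric] Aut_group_def End_monoid_def Bij_def left_mult_def)
  qed
  have "\<kappa> \<otimes>\<^bsub>End_monoid X tr\<^esub> s = s \<otimes>\<^bsub>End_monoid X tr\<^esub> \<kappa>" if "s \<in> LMlt X tr" for s
  proof (rule monoid.commutes_with_generate[OF monoid_End_monoid,
        where C = "carrier (Aut_group X tr)" and H = "left_mult X tr ` X"])
    have eq: "(End_monoid X tr)\<lparr>carrier := carrier (Aut_group X tr)\<rparr> = Aut_group X tr"
      by (simp add: Aut_group_def)
    show "group ((End_monoid X tr)\<lparr>carrier := carrier (Aut_group X tr)\<rparr>)"
      unfolding eq using closed by (rule group_Aut_group)
    show "s \<in> generate ((End_monoid X tr)\<lparr>carrier := carrier (Aut_group X tr)\<rparr>)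
        (left_mult X tr ` X)"
      unfolding eq using that by (simp add: LMlt_def)
    show "\<kappa> \<otimes>\<^bsub>End_monoid X tr\<^esub> h = h \<otimes>\<^bsub>End_monoid X tr\<^esub> \<kappa>" if "h \<in> left_mult X tr ` X" for h
      using that \<kappa> comm closed by (auto simp: End_monoid_def compose_left_mult_commute_iff)
  qed (use closed k L_Aut in \<open>auto simp: Aut_group_def\<close>)
  then show ?L using k by (simp add: centralizer_def)
qed

lemma centralizer_Aut_group_iff:
  "\<kappa> \<in> centralizer (Aut_group X tr) S
    \<longleftrightarrow> \<kappa> \<in> centralizer (End_monoid X tr) S \<and> bij_betw \<kappa> X X"
  by (auto simp: centralizer_def Aut_group_def End_monoid_def Bij_def PiE_def)

section \<open>The rack of a left non-degenerate solution\<close>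

locale left_nondegenerate_solution =
  fixes X :: "'a set" and r :: "'a \<times> 'a \<Rightarrow> 'a \<times> 'a"
  assumes YB: "YB_solution X r" and left_nondeg: "left_nondegenerate X r"
begin

abbreviation l where "l \<equiv> lam r"
abbreviation \<rho> where "\<rho> \<equiv> rho r"
abbreviation sh (infixl "\<triangleright>" 70) where "sh \<equiv> shelf_op X r"

lemma lam_closed [simp]: "x \<in> X \<Longrightarrow> y \<in> X \<Longrightarrow> l x y \<in> X"
  and rho_closed [simp]: "x \<in> X \<Longrightarrow> y \<in> X \<Longrightarrow> \<rho> y x \<in> X"
  using YB unfolding YB_solution_def lam_def rho_def
  by (metis PiE SigmaI mem_Times_iff)+

lemma r_eq: "r (x, y) = (l x y, \<rho> y x)"
  by (simp add: lam_def rho_def)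

lemma bij_lam: "x \<in> X \<Longrightarrow> bij_betw (l x) X X"
  using left_nondeg by (simp add: left_nondegenerate_def)

lemma lam_eq_iff: "x \<in> X \<Longrightarrow> y \<in> X \<Longrightarrow> z \<in> X \<Longrightarrow> l x y = l x z \<longleftrightarrow> y = z"
  using inj_on_eq_iff[OF bij_betw_imp_inj_on[OF bij_lam]] .

lemma lam_surj:
  assumes "x \<in> X" "u \<in> X" obtains z where "z \<in> X" "u = l x z"
  using bij_betw_imp_surj_on[OF bij_lam[OF assms(1)]] assms(2) by blast

lemma
  assumes "x \<in> X" "y \<in> X" "z \<in> X"
  shows YB_lam: "l x (l y z) = l (l x y) (l (\<rho> y x) z)"
    and YB_mixed: "l (\<rho> (l y z) x) (\<rho> z y) = \<rho> (l (\<rho> y x) z) (l x y)"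
    and YB_rho: "\<rho> z (\<rho> y x) = \<rho> (\<rho> z y) (\<rho> (l y z) x)"
proof -
  have "(r12 r \<circ> r23 r \<circ> r12 r) (x, y, z) = (r23 r \<circ> r12 r \<circ> r23 r) (x, y, z)"
    using YB assms unfolding YB_solution_def by blast
  then show "l x (l y z) = l (l x y) (l (\<rho> y x) z)"
    "l (\<rho> (l y z) x) (\<rho> z y) = \<rho> (l (\<rho> y x) z) (l x y)"
    "\<rho> z (\<rho> y x) = \<rho> (\<rho> z y) (\<rho> (l y z) x)"
    by (simp_all add: r12_def r23_def r_eq)
qed

text \<open>
  Every element of \<open>X\<close> can be written as \<open>\<lambda>\<^sub>y z\<close>, so this determines \<open>\<triangleright>\<close> without mentioning an
  inverse of \<open>\<lambda>\<^sub>y\<close>. All later computations substitute in this way.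
\<close>

lemma shelf_op_lam: "y \<in> X \<Longrightarrow> z \<in> X \<Longrightarrow> l y z \<triangleright> y = l (l y z) (\<rho> z y)"
  by (simp add: shelf_op_def bij_betw_inv_into_left[OF bij_lam])

lemma shelf_op_closed [simp]: "x \<in> X \<Longrightarrow> y \<in> X \<Longrightarrow> x \<triangleright> y \<in> X"
  by (metis lam_surj shelf_op_lam lam_closed rho_closed)

text \<open>
  For \<open>u = \<lambda>\<^sub>y z\<close> the left-hand side is \<open>\<lambda>\<^sub>x \<lambda>\<^sub>u \<rho>\<^sub>z y\<close>. The first coordinate of the Yang--Baxter equation
  moves \<open>\<lambda>\<^sub>x\<close> past \<open>\<lambda>\<^sub>u\<close>, and the middle coordinate then moves the resulting \<open>\<lambda>\<close> inside \<open>\<rho>\<close>.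
\<close>

lemma lam_shelf_op:
  assumes "x \<in> X" "u \<in> X" "y \<in> X"
  shows "l x (u \<triangleright> y) = l x u \<triangleright> l x y"
proof -
  obtain z where z: "z \<in> X" and u: "u = l y z" using lam_surj assms by metis
  have "l x (u \<triangleright> y) = l x (l u (\<rho> z y))" using assms z by (simp add: u shelf_op_lam)
  also have "\<dots> = l (l x u) (l (\<rho> u x) (\<rho> z y))" using assms z by (intro YB_lam) auto
  also have "\<dots> = l (l x u) (\<rho> (l (\<rho> y x) z) (l x y))"
    using YB_mixed[OF assms(1,3) z] by (simp add: u)
  also have "\<dots> = l x u \<triangleright> l x y"
    using assms z shelf_op_lam[of "l x y" "l (\<rho> y x) z"] YB_lam[OF assms(1,3) z] by (simp add: u)
  finally show ?thesis .
qed

text \<open>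
  In the coordinates \<open>(a, b, c) = (x, \<lambda>\<^sub>x y, \<lambda>\<^sub>x \<lambda>\<^sub>y z)\<close> the two sides of the Yang--Baxter equation
  become \<open>(c, c \<triangleright> b, c \<triangleright> (b \<triangleright> a))\<close> and \<open>(c, c \<triangleright> b, (c \<triangleright> b) \<triangleright> (c \<triangleright> a))\<close>. Their last components agree
  because of the third coordinate of the equation.
\<close>

lemma shelf_op_self_distrib:
  assumes "c \<in> X" "b \<in> X" "a \<in> X"
  shows "c \<triangleright> (b \<triangleright> a) = (c \<triangleright> b) \<triangleright> (c \<triangleright> a)"
proof -
  obtain y where y: "y \<in> X" and b: "b = l a y" using lam_surj assms by metis
  obtain w where w: "w \<in> X" and cw: "c = l a w" using lam_surj assms by metis
  obtain z where z: "z \<in> X" and wz: "w = l y z" using lam_surj w y by metis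
  define q where "q = \<rho> y a"
  define s where "s = \<rho> w a"
  define t where "t = \<rho> z y"
  have mem [simp]: "q \<in> X" "s \<in> X" "t \<in> X" using assms y w z by (auto simp: q_def s_def t_def)
  have c: "c = l b (l q z)" using YB_lam[OF assms(3) y z] by (simp add: cw wz b q_def)
  have ba: "b \<triangleright> a = l b q" using assms y by (simp add: b q_def shelf_op_lam)
  have ca: "c \<triangleright> a = l c s" using assms w by (simp add: cw s_def shelf_op_lam)
  have "c \<triangleright> b = l a (w \<triangleright> y)" using assms y w by (simp add: cw b lam_shelf_op)
  also have "\<dots> = l a (l w t)" using y z by (simp add: wz t_def shelf_op_lam)
  also have "\<dots> = l c (l s t)" using YB_lam[OF assms(3) w mem(3)] by (simp add: cw s_def)
  finally have cb: "c \<triangleright> b = l c (l s t)" .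
  have "c \<triangleright> (b \<triangleright> a) = l b (l q z \<triangleright> q)"
    unfolding ba using assms z by (subst c) (simp add: lam_shelf_op)
  also have "\<dots> = l b (l (l q z) (\<rho> z q))" using z by (simp add: shelf_op_lam)
  also have "\<dots> = l c (l (\<rho> (l q z) b) (\<rho> z q))"
    using YB_lam[of b "l q z" "\<rho> z q"] assms z by (simp add: c)
  also have "\<dots> = l c (l (l s t) (\<rho> t s))"
  proof -
    have "\<rho> (l q z) b = l s t"
      using YB_mixed[OF assms(3) y z] by (simp add: b q_def s_def t_def wz)
    moreover have "\<rho> z q = \<rho> t s"
      using YB_rho[OF assms(3) y z] by (simp add: q_def s_def t_def wz)
    ultimately show ?thesis by simp
  qed
  also have "\<dots> = l c (l s t \<triangleright> s)" by (simp add: shelf_op_lam)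
  also have "\<dots> = (c \<triangleright> b) \<triangleright> (c \<triangleright> a)" using assms by (simp add: cb ca lam_shelf_op)
  finally show ?thesis .
qed

text \<open>
  With \<open>u = \<lambda>\<^sub>y z\<close> the value \<open>r (y, z)\<close> is \<open>(u, \<lambda>\<^sub>u\<^sup>-\<^sup>1 (u \<triangleright> y))\<close>. So injectivity and surjectivity
  of \<open>r\<close>, restricted to a fixed first component \<open>u\<close>, are those of \<open>L\<^sub>u\<close>.
\<close>

lemma bij_betw_shelf_op:
  assumes bij: "bij_betw r (X \<times> X) (X \<times> X)" and u: "u \<in> X"
  shows "bij_betw (sh u) X X"
proof (rule bij_betw_imageI)
  show "inj_on (sh u) X"
  proof (rule inj_onI)
    fix y y' assume y: "y \<in> X" "y' \<in> X" and eq: "u \<triangleright> y = u \<triangleright> y'"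
    obtain z where z: "z \<in> X" "u = l y z" using lam_surj u y by metis
    obtain z' where z': "z' \<in> X" "u = l y' z'" using lam_surj u y by metis
    have "l u (\<rho> z y) = l u (\<rho> z' y')"
      using eq y z z' shelf_op_lam by metis
    then have "\<rho> z y = \<rho> z' y'" using u y z(1) z'(1) by (simp add: lam_eq_iff)
    then have "r (y, z) = r (y', z')" using z z' by (simp add: r_eq)
    then show "y = y'"
      using bij y z z' by (auto simp: bij_betw_def dest: inj_onD)
  qed
next
  have "w \<in> sh u ` X" if w: "w \<in> X" for w
  proof -
    obtain v where v: "v \<in> X" "w = l u v" using lam_surj u w by metis
    then have "(u, v) \<in> r ` (X \<times> X)" using bij u by (simp add: bij_betw_def)
    then obtain y z where yz: "y \<in> X" "z \<in> X" "u = l y z" "v = \<rho> z y" by (auto simp: r_eq)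
    then have "w = u \<triangleright> y" using v shelf_op_lam by simp
    then show ?thesis using yz by blast
  qed
  then show "sh u ` X = X" using u by auto
qed

section \<open>The reflection equation in terms of the shelf\<close>

definition shear :: "'a \<times> 'a \<Rightarrow> 'a \<times> 'a" where
  "shear = (\<lambda>(x, y). (x, l x y))"

definition shelf_flip :: "'a \<times> 'a \<Rightarrow> 'a \<times> 'a" where
  "shelf_flip = (\<lambda>(y, u). (u, u \<triangleright> y))"

lemma bij_betw_shear: "bij_betw shear (X \<times> X) (X \<times> X)"
proof (rule bij_betw_imageI)
  show "inj_on shear (X \<times> X)"
    by (rule inj_onI) (auto simp: shear_def lam_eq_iff)
  show "shear ` (X \<times> X) = X \<times> X"
  proof
    show "X \<times> X \<subseteq> shear ` (X \<times> X)"
    proof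
      fix p assume "p \<in> X \<times> X"
      then obtain x u z where "x \<in> X" "z \<in> X" "p = (x, u)" "u = l x z"
        by (metis SigmaE lam_surj)
      then show "p \<in> shear ` (X \<times> X)" by (force simp: shear_def)
    qed
  qed (auto simp: shear_def)
qed

lemma shear_r: "p \<in> X \<times> X \<Longrightarrow> shear (r p) = shelf_flip (shear p)"
  by (auto simp: shear_def shelf_flip_def r_eq shelf_op_lam)

lemma r_closed: "p \<in> X \<times> X \<Longrightarrow> r p \<in> X \<times> X"
  by (auto simp: r_eq)

text \<open>
  Since \<^term>\<open>shear\<close> intertwines \<open>r\<close> with \<^term>\<open>shelf_flip\<close> and commutes with \<open>id \<times> \<kappa>\<close>, the
  reflection equation for \<open>r\<close> is the one for \<^term>\<open>shelf_flip\<close>; the two shelf equations are its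
  coordinates.
\<close>

lemma reflection_iff_shelf_equations:
  assumes "lambda_centralizing X r \<kappa>"
  shows "reflection X r \<kappa> \<longleftrightarrow>
    (\<forall>u \<in> X. \<forall>y \<in> X. \<kappa> (\<kappa> u \<triangleright> y) = \<kappa> (u \<triangleright> y) \<and>
      \<kappa> (\<kappa> u \<triangleright> y) \<triangleright> \<kappa> u = \<kappa> (\<kappa> (u \<triangleright> y) \<triangleright> u))"
proof -
  define K :: "'a \<times> 'a \<Rightarrow> 'a \<times> 'a" where "K = map_prod id \<kappa>"
  have \<kappa>: "\<kappa> \<in> X \<rightarrow>\<^sub>E X" using assms by (simp add: lambda_centralizing_def)
  have K_closed: "K p \<in> X \<times> X" if "p \<in> X \<times> X" for p
    using that \<kappa> by (auto simp: K_def)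
  have shear_K: "shear (K p) = K (shear p)" if "p \<in> X \<times> X" for p
    using that assms by (auto simp: K_def shear_def lambda_centralizing_def)
  note closed = K_closed r_closed
  have "(r \<circ> K \<circ> r \<circ> K) p = (K \<circ> r \<circ> K \<circ> r) p \<longleftrightarrow>
      shelf_flip (K (shelf_flip (K (shear p)))) = K (shelf_flip (K (shelf_flip (shear p))))"
    if p: "p \<in> X \<times> X" for p
  proof -
    have "(r \<circ> K \<circ> r \<circ> K) p = (K \<circ> r \<circ> K \<circ> r) p \<longleftrightarrow>
        shear (r (K (r (K p)))) = shear (K (r (K (r p))))"
      using inj_on_eq_iff[OF bij_betw_imp_inj_on[OF bij_betw_shear],
          of "r (K (r (K p)))" "K (r (K (r p)))"]
        p closed by simp
    then show ?thesis using p closed by (simp add: shear_r shear_K)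
  qed
  then have "reflection X r \<kappa> \<longleftrightarrow> (\<forall>p \<in> X \<times> X.
      shelf_flip (K (shelf_flip (K (shear p)))) = K (shelf_flip (K (shelf_flip (shear p)))))"
    using \<kappa> by (simp add: reflection_def K_def[symmetric])
  also have "\<dots> \<longleftrightarrow> (\<forall>p \<in> shear ` (X \<times> X).
      shelf_flip (K (shelf_flip (K p))) = K (shelf_flip (K (shelf_flip p))))"
    by blast
  also have "shear ` (X \<times> X) = X \<times> X"
    using bij_betw_shear by (rule bij_betw_imp_surj_on)
  finally show ?thesis by (auto simp: K_def shelf_flip_def)
qed

text \<open>
  In the first shelf equation both sides equal \<open>\<kappa> u \<triangleright> \<kappa> y\<close>: the left one by commuting with
  \<open>L (\<kappa> u)\<close>, the right one by the endomorphism property. Then commuting with \<open>L (\<kappa> (u \<triangleright> y))\<close> gives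
  the second equation.
\<close>

lemma reflection_if_commuting_endomorphism:
  assumes "lambda_centralizing X r \<kappa>"
    and hom: "\<And>x y. x \<in> X \<Longrightarrow> y \<in> X \<Longrightarrow> \<kappa> (x \<triangleright> y) = \<kappa> x \<triangleright> \<kappa> y"
    and comm: "\<And>x y. x \<in> X \<Longrightarrow> y \<in> X \<Longrightarrow> \<kappa> (x \<triangleright> y) = x \<triangleright> \<kappa> y"
  shows "reflection X r \<kappa>"
proof -
  have \<kappa>: "\<kappa> u \<in> X" if "u \<in> X" for u
    using assms(1) that by (auto simp: lambda_centralizing_def)
  have 1: "\<kappa> (\<kappa> u \<triangleright> y) = \<kappa> (u \<triangleright> y)" if "u \<in> X" "y \<in> X" for u y
    using that comm[of "\<kappa> u" y] hom[of u y] \<kappa> by simp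
  have 2: "\<kappa> (\<kappa> (u \<triangleright> y) \<triangleright> u) = \<kappa> (u \<triangleright> y) \<triangleright> \<kappa> u" if "u \<in> X" "y \<in> X" for u y
    using that comm[of "\<kappa> (u \<triangleright> y)" u] \<kappa> by simp
  show ?thesis
    using 1 2 by (simp add: reflection_iff_shelf_equations[OF assms(1)])
qed

text \<open>
  Injectivity cancels the outer \<open>\<kappa>\<close> in the first shelf equation, so \<open>x\<close> and \<open>\<kappa> x\<close> act in the same
  way on \<open>X\<close>. This makes the two claims equivalent, and the first one is the second shelf equation
  once \<open>x\<close> is written as \<open>y \<triangleright> v\<close>; this is where bijectivity of \<open>r\<close> is used.
\<close>

lemma injective_reflection_commutes:
  assumes "lambda_centralizing X r \<kappa>" "reflection X r \<kappa>" "inj_on \<kappa> X"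
    and bij: "bij_betw r (X \<times> X) (X \<times> X)"
    and xy: "x \<in> X" "y \<in> X"
  shows "\<kappa> (x \<triangleright> y) = \<kappa> x \<triangleright> \<kappa> y" and "\<kappa> (x \<triangleright> y) = x \<triangleright> \<kappa> y"
proof -
  have \<kappa>: "\<kappa> u \<in> X" if "u \<in> X" for u
    using assms(1) that by (auto simp: lambda_centralizing_def)
  have eq1: "\<kappa> (\<kappa> u \<triangleright> v) = \<kappa> (u \<triangleright> v)"
    and eq2: "\<kappa> (\<kappa> u \<triangleright> v) \<triangleright> \<kappa> u = \<kappa> (\<kappa> (u \<triangleright> v) \<triangleright> u)" if "u \<in> X" "v \<in> X" for u v
    using assms(2) that unfolding reflection_iff_shelf_equations[OF assms(1)] by blast+
  have L: "\<kappa> u \<triangleright> v = u \<triangleright> v" if "u \<in> X" "v \<in> X" for u v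
    by (rule inj_onD[OF assms(3) eq1]) (use that \<kappa> in simp_all)
  obtain v where v: "v \<in> X" "x = y \<triangleright> v"
    using bij_betw_imp_surj_on[OF bij_betw_shelf_op[OF bij xy(2)]] xy(1) by blast
  have "\<kappa> x \<triangleright> \<kappa> y = \<kappa> (\<kappa> x \<triangleright> y)"
    using eq1[OF xy(2) v(1)] eq2[OF xy(2) v(1)] by (simp only: v(2))
  also have "\<dots> = \<kappa> (x \<triangleright> y)" using L[OF xy] by (rule arg_cong)
  finally show hom: "\<kappa> (x \<triangleright> y) = \<kappa> x \<triangleright> \<kappa> y" ..
  also have "\<dots> = x \<triangleright> \<kappa> y" using xy \<kappa> by (intro L)
  finally show "\<kappa> (x \<triangleright> y) = x \<triangleright> \<kappa> y" .
qed

end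

theorem theorem2p11:
  fixes X :: "'a set" and r :: "'a \<times> 'a \<Rightarrow> 'a \<times> 'a" and \<kappa> :: "'a \<Rightarrow> 'a"
  assumes "bijective_solution X r"
    and "left_nondegenerate X r"
    and "\<kappa> \<in> X \<rightarrow>\<^sub>E X"
    and "lambda_centralizing X r \<kappa>"
  shows "(\<kappa> \<in> centralizer (End_monoid X (shelf_op X r)) (LMlt X (shelf_op X r))
            \<longrightarrow> reflection X r \<kappa>)
       \<and> (reflection X r \<kappa> \<and> inj_on \<kappa> X
            \<longrightarrow> \<kappa> \<in> centralizer (End_monoid X (shelf_op X r)) (LMlt X (shelf_op X r)))
       \<and> (reflection X r \<kappa> \<and> bij_betw \<kappa> X X
            \<longleftrightarrow> \<kappa> \<in> centralizer (Aut_group X (shelf_op X r)) (LMlt X (shelf_op X r)))"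
proof -
  interpret left_nondegenerate_solution X r
    using assms by unfold_locales (simp_all add: bijective_solution_def)
  have bij: "bij_betw r (X \<times> X) (X \<times> X)" using assms(1) by (simp add: bijective_solution_def)
  let ?C = "\<kappa> \<in> centralizer (End_monoid X (shelf_op X r)) (LMlt X (shelf_op X r))"
  have C_iff: "?C \<longleftrightarrow> (\<forall>x \<in> X. \<forall>y \<in> X.
      \<kappa> (shelf_op X r x y) = shelf_op X r (\<kappa> x) (\<kappa> y) \<and>
      \<kappa> (shelf_op X r x y) = shelf_op X r x (\<kappa> y))"
    using assms(3) centralizer_LMlt_iff[of X "shelf_op X r" \<kappa>,
        OF shelf_op_closed bij_betw_shelf_op[OF bij] shelf_op_self_distrib] by simp
  have 1: "reflection X r \<kappa>" if ?C
    using that unfolding C_iff by (intro reflection_if_commuting_endomorphism[OF assms(4)]) blast+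
  have 2: ?C if "reflection X r \<kappa>" "inj_on \<kappa> X"
    unfolding C_iff using injective_reflection_commutes[OF assms(4) that bij] by blast
  have 3: "reflection X r \<kappa> \<and> bij_betw \<kappa> X X
      \<longleftrightarrow> \<kappa> \<in> centralizer (Aut_group X (shelf_op X r)) (LMlt X (shelf_op X r))"
    unfolding centralizer_Aut_group_iff using 1 2 bij_betw_imp_inj_on by blast
  show ?thesis using 1 2 3 by blast
qed

end
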